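(* Let $\mu$ be a probability measure on $[0,1]$ with cumulative function $F$ and let $p\in(0,1)$. The solution $(q_t)_{t\ge0}$ of the equation $$q_t=\mathsf{b}[q_t-t,q_t+t]+t\;\frac{p-F((q_t-t)^-)-(F(q_t+t)-p)}{F(q_t+t)-F((q_t-t)^-)}$$ is the unique solution of the system $$\frac{dq_t}{dt}=u_t\,\mathbf{1}\{q_t\in(0,1)\},\quad w_t=p-F((q_t-t)^-),\quad \ell_t=F(q_t+t)-p,\quad u_t=\frac{w_t-\ell_t}{w_t+\ell_t},\quad q_0=F^{-1}(p).$$
   Context: $F(x)=\mu([0,x])$, with $F=0$ on $(-\infty,0)$ and $F=1$ on $(1,\infty)$; $F(x^-)$ is the left limit; $F^{-1}(p)=\inf\{x\ge0:F(x)\ge p\}$. For $\alpha\le\beta$, $\mathsf{b}[\alpha,\beta]$ is the barycenter of the mass of $\mu$ restricted to $[\alpha,\beta]$: $$\mathsf{b}[\alpha,\beta]=\frac{1}{F(\beta)-F(\alpha^-)}\int_{[\alpha,\beta]}z\,d\mu(z)=\beta-\int_{\alpha}^{\beta}\frac{F(z)-F(\alpha^-)}{F(\beta)-F(\alpha^-)}\,dz .$$ The system describes the max-price $q_t$ of a continuous auction model with initial bid distribution $\mu$ and winning fraction $p$; $w_t$ and $\ell_t$ are the winning and losing masses at the max-price at time $t$, and $u_t$ is the max-price velocity.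
   Formalization: The equation's solution is stopped on first leaving (0,1); it is taken continuous with q_0=F^{-1}(p); dq/dt is a right derivative; quotients must be defined for t>0, and t=0 is imposed only if defined; existence assumes μ[q_0,x]>0 for all x>q_0. *)

theory Defs
  imports "HOL-Probability.Probability"
begin

(* The cumulative function F is the library's cdf: when M is concentrated on {0..1}, cdf M x is the
   mass of {0..x}, it vanishes for x < 0 and equals 1 for x > 1. *)

definition cdf_minus :: "real measure \<Rightarrow> real \<Rightarrow> real" where
  "cdf_minus M x = Lim (at_left x) (cdf M)"

definition quantile :: "real measure \<Rightarrow> real \<Rightarrow> real" where
  "quantile M p = Inf {x. 0 \<le> x \<and> p \<le> cdf M x}"

(* Meaningful only if the denominator is nonzero. *)
definition barycenter :: "real measure \<Rightarrow> real \<Rightarrow> real \<Rightarrow> real" where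
  "barycenter M a b = (LINT z:{a..b}|M. z) / (cdf M b - cdf_minus M a)"

definition winning_mass :: "real measure \<Rightarrow> real \<Rightarrow> (real \<Rightarrow> real) \<Rightarrow> real \<Rightarrow> real" where
  "winning_mass M p q t = p - cdf_minus M (q t - t)"

definition losing_mass :: "real measure \<Rightarrow> real \<Rightarrow> (real \<Rightarrow> real) \<Rightarrow> real \<Rightarrow> real" where
  "losing_mass M p q t = cdf M (q t + t) - p"

definition velocity :: "real measure \<Rightarrow> real \<Rightarrow> (real \<Rightarrow> real) \<Rightarrow> real \<Rightarrow> real" where
  "velocity M p q t = (winning_mass M p q t - losing_mass M p q t) /
                      (winning_mass M p q t + losing_mass M p q t)"

(* A solution is a continuous trajectory started at the p-quantile. For t > 0 the quotients must make
   sense. At t = 0 they are 0/0 whenever M has no atom at the quantile, so there nothing is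
   required unless they make sense (and then the equation reads q 0 = q 0). *)
definition solves_equation :: "real measure \<Rightarrow> real \<Rightarrow> (real \<Rightarrow> real) \<Rightarrow> bool" where
  "solves_equation M p q \<longleftrightarrow>
     continuous_on {0..} q \<and>
     q 0 = quantile M p \<and>
     (\<forall>t\<ge>0.
        (0 < t \<longrightarrow> cdf M (q t + t) - cdf_minus M (q t - t) \<noteq> 0) \<and>
        (cdf M (q t + t) - cdf_minus M (q t - t) \<noteq> 0 \<longrightarrow>
           q t = barycenter M (q t - t) (q t + t) +
                 t * ((p - cdf_minus M (q t - t) - (cdf M (q t + t) - p)) /
                      (cdf M (q t + t) - cdf_minus M (q t - t)))))"

(* The time derivative is the right derivative: q has kinks at the times when q t - t or q t + t meets
   an atom of M, and the one-sided limits chosen in the two masses are their right limits in time.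
   As for the equation, the velocity must make sense for t > 0, and the differential equation is
   imposed at t = 0 if it makes sense there. *)
definition solves_system :: "real measure \<Rightarrow> real \<Rightarrow> (real \<Rightarrow> real) \<Rightarrow> bool" where
  "solves_system M p q \<longleftrightarrow>
     continuous_on {0..} q \<and>
     q 0 = quantile M p \<and>
     (\<forall>t\<ge>0.
        (0 < t \<longrightarrow> winning_mass M p q t + losing_mass M p q t \<noteq> 0) \<and>
        (winning_mass M p q t + losing_mass M p q t \<noteq> 0 \<longrightarrow>
           (q has_real_derivative velocity M p q t * indicator {0<..<1} (q t)) (at_right t)))"

(* The indicator in the system freezes the price once it has left the open unit interval, whereas
   solutions of the equation continue beyond 0 or 1; the two are compared by stopping. *)
definition stopped_at_exit :: "(real \<Rightarrow> real) \<Rightarrow> real \<Rightarrow> real" where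
  "stopped_at_exit q t =
     (if \<forall>s\<in>{0..t}. q s \<in> {0<..<1} then q t
      else q (Inf {s. 0 \<le> s \<and> q s \<notin> {0<..<1}}))"

end

theory Submission
  imports Defs
begin

text \<open>
  Put \<open>G x = E (x - X)\<^sup>+ - p x\<close> for \<open>X\<close> distributed according to \<open>M\<close>: a convex function with one-sided
  derivatives \<open>F - p\<close>, whose leftmost minimizer is the \<open>p\<close>-quantile. Expanding the barycenter turns the
  equation into \<open>G (q t + t) = G (q t - t)\<close>, and the non-degeneracy of the quotients forces
  \<open>q t - t \<le> quantile M p \<le> q t + t\<close>; strict monotonicity of \<open>G\<close> to the left of the quantile then leaves at
  most one such \<open>q t\<close>. Both end points \<open>q t \<plusminus> t\<close> move outwards, so the one-sided slopes of \<open>G\<close> give the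
  right derivative of \<open>q\<close>. Conversely, along a solution of the system that has not left the open unit
  interval, \<open>G (q t + t) - G (q t - t)\<close> has right derivative \<open>0\<close>. After the exit, a solution of the system
  cannot re-enter, because where it left the boundary its right derivative would have to be both
  zero and bounded away from zero.
\<close>

section \<open>Right derivatives and first exits\<close>

text \<open>Tilting \<open>f\<close> by a small positive slope turns \<open>d \<le> 0\<close> into a
  strict decrease, which contradicts the choice of the last time at which the tilted function is
  nonpositive. Derivatives are asked for only after \<open>s\<close>, because the velocity may be
  0/0 at time 0.\<close>

lemma right_derivative_barrier:
  fixes f :: "real \<Rightarrow> real"
  assumes "s \<le> T" and cont: "continuous_on {s..T} f" and "f s \<le> c"
    and deriv: "\<And>t. s < t \<Longrightarrow> t < T \<Longrightarrow> c < f t \<Longrightarrow>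
      \<exists>d\<le>0. (f has_real_derivative d) (at_right t)"
  shows "f T \<le> c"
proof (rule ccontr)
  assume "\<not> f T \<le> c"
  then have fT: "c < f T" and "s < T"
    using assms(1,3) by (auto simp: less_le)
  \<comment> \<open>The tilt \<open>e * (t - s + 1)\<close> uses up half of \<open>f T - c\<close>
    at time \<open>T\<close>. The summand 1 makes \<open>g s\<close> negative, which puts the last
    zero \<open>m\<close> strictly after \<open>s\<close>.\<close>
  define e where "e = (f T - c) / (2 * (T - s + 1))"
  have "e > 0"
    unfolding e_def using fT \<open>s < T\<close> by simp
  have eT: "e * (T - s + 1) = (f T - c) / 2"
    unfolding e_def using \<open>s < T\<close> by (simp add: field_simps)
  define g where "g t = f t - c - e * (t - s + 1)" for t
  have contg: "continuous_on {s..T} g"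
    unfolding g_def by (intro continuous_intros cont)
  have gT: "g T > 0"
    unfolding g_def eT using fT by (simp add: field_simps)
  have gs: "g s < 0"
    unfolding g_def using assms(3) \<open>e > 0\<close> by simp
  define S where "S = {t \<in> {s..T}. g t \<le> 0}"
  have "compact S"
    using continuous_on_closed_Collect_le[OF contg continuous_on_const, of 0]
    by (auto simp: S_def intro!: compact_eq_bounded_closed[THEN iffD2] intro: bounded_subset[OF bounded_closed_interval])
  moreover have "s \<in> S"
    using gs \<open>s < T\<close> by (simp add: S_def)
  ultimately obtain m where m: "m \<in> S" "\<And>t. t \<in> S \<Longrightarrow> t \<le> m"
    using compact_attains_sup[of S] by blast
  have "s \<le> m" "m < T" "g m \<le> 0"
    using m(1) gT unfolding S_def by (auto simp: less_le)
  obtain x where x: "m \<le> x" "x \<le> T" "g x = 0"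
    using IVT'[of g m 0 T] \<open>m < T\<close> \<open>g m \<le> 0\<close> gT
      continuous_on_subset[OF contg, of "{m..T}"] \<open>s \<le> m\<close> by auto
  then have "x \<in> S"
    using \<open>s \<le> m\<close> by (simp add: S_def)
  then have gm: "g m = 0"
    using m(2)[of x] x by (simp add: antisym)
  have "s < m"
    using gm gs \<open>s \<le> m\<close> by (cases "s = m") auto
  have "0 < e * (m - s + 1)"
    using \<open>e > 0\<close> \<open>s < m\<close> by simp
  then have "c < f m"
    using gm unfolding g_def by linarith
  then obtain d where d: "d \<le> 0" "(f has_real_derivative d) (at_right m)"
    using deriv[OF \<open>s < m\<close> \<open>m < T\<close>] by blast
  have "(g has_real_derivative d - e) (at_right m)"
    unfolding g_def by (rule derivative_eq_intros d(2) refl | simp)+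
  then obtain r where r: "r > 0" "\<And>h. h > 0 \<Longrightarrow> m + h \<in> {m<..} \<Longrightarrow> h < r \<Longrightarrow> g (m + h) < g m"
    using has_real_derivative_neg_dec_right[of g "d - e" m "{m<..}"] d(1) \<open>e > 0\<close> by auto
  define h where "h = min r (T - m) / 2"
  have h: "h > 0" "h < r" "m + h \<le> T"
    unfolding h_def using r(1) \<open>m < T\<close> by (auto simp: min_def field_simps)
  then have "g (m + h) < 0"
    using r(2)[of h] gm by simp
  then have "m + h \<in> S"
    using h \<open>s \<le> m\<close> by (simp add: S_def)
  then show False
    using m(2)[of "m + h"] h(1) by simp
qed

lemma stopped_at_exit_inside: "\<forall>s\<in>{0..t}. q s \<in> {0<..<1} \<Longrightarrow> stopped_at_exit q t = q t"
  by (simp add: stopped_at_exit_def)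

lemma stopped_at_exit_outside:
  assumes "0 \<le> \<tau>" "q \<tau> \<notin> {0<..<1}" "\<forall>s\<in>{0..<\<tau>}. q s \<in> {0<..<1}" "\<tau> \<le> t"
  shows "stopped_at_exit q t = q \<tau>"
proof -
  have "Inf {s. 0 \<le> s \<and> q s \<notin> {0<..<1}} = \<tau>"
    using assms by (intro cInf_eq_minimum) (auto simp: not_less[symmetric])
  moreover have "\<not> (\<forall>s\<in>{0..t}. q s \<in> {0<..<1})"
    using assms by auto
  then have "stopped_at_exit q t = q (Inf {s. 0 \<le> s \<and> q s \<notin> {0<..<1}})"
    unfolding stopped_at_exit_def by (rule if_not_P)
  ultimately show ?thesis
    by (rule back_subst[of "\<lambda>s. stopped_at_exit q t = q s", rotated])
qed

text \<open>Continuity makes the set of times in \<open>{0..t}\<close> spent outside the open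
  interval compact, so a first such time is attained.\<close>

lemma first_exit:
  fixes q :: "real \<Rightarrow> real"
  assumes "continuous_on {0..} q"
  obtains "\<forall>s\<in>{0..t}. q s \<in> {0<..<1}"
  | \<tau> where "0 \<le> \<tau>" "\<tau> \<le> t" "q \<tau> \<notin> {0<..<1}" "\<forall>s\<in>{0..<\<tau>}. q s \<in> {0<..<1}"
proof (cases "\<forall>s\<in>{0..t}. q s \<in> {0<..<1}")
  case False
  let ?E = "{0..t} \<inter> q -` (- {0<..<1})"
  have "closed ?E"
    using assms by (intro continuous_closed_preimage) (auto elim: continuous_on_subset)
  then have "compact ?E"
    by (auto intro!: compact_eq_bounded_closed[THEN iffD2] intro: bounded_subset[OF bounded_closed_interval])
  moreover have "?E \<noteq> {}"
    using False by auto
  ultimately obtain \<tau> where \<tau>: "\<tau> \<in> ?E" "\<And>s. s \<in> ?E \<Longrightarrow> \<tau> \<le> s"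
    using compact_attains_inf[of ?E] by blast
  have "q s \<in> {0<..<1}" if "s \<in> {0..<\<tau>}" for s
  proof (rule ccontr)
    assume "q s \<notin> {0<..<1}"
    then have "s \<in> ?E" using that \<tau>(1) by simp
    then show False using \<tau>(2)[of s] that by simp
  qed
  then show thesis
    using \<tau>(1) by (intro that(2)[of \<tau>]) auto
qed (rule that(1))

text \<open>The alternatives are evaluated at the last zero of \<open>f\<close>, where the second one contradicts the
  vanishing right derivative.\<close>

lemma no_departure:
  fixes f :: "real \<Rightarrow> real"
  assumes "\<tau> \<le> T" and cont: "continuous_on {\<tau>..T} f" and "f \<tau> = 0"
    and deriv: "\<And>s. \<tau> \<le> s \<Longrightarrow> s < T \<Longrightarrow> f s = 0 \<Longrightarrow> (f has_real_derivative 0) (at_right s)"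
    and dich: "\<And>s. \<tau> \<le> s \<Longrightarrow> s < T \<Longrightarrow> f s = 0 \<Longrightarrow> (\<And>t. s < t \<Longrightarrow> t < T \<Longrightarrow> 0 < f t) \<Longrightarrow>
      (\<forall>t\<in>{s<..<T}. \<exists>d\<le>0. (f has_real_derivative d) (at_right t)) \<or>
      (\<exists>c>0. eventually (\<lambda>t. \<exists>d\<ge>c. (f has_real_derivative d) (at_right t)) (at_right s))"
  shows "f T \<le> 0"
proof (rule ccontr)
  assume "\<not> f T \<le> 0"
  then have fT: "0 < f T" by simp
  let ?Z = "{\<tau>..T} \<inter> f -` {0}"
  have "closed ?Z"
    using cont by (intro continuous_closed_preimage) auto
  then have "compact ?Z"
    by (auto intro!: compact_eq_bounded_closed[THEN iffD2] intro: bounded_subset[OF bounded_closed_interval])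
  moreover have "?Z \<noteq> {}"
    using assms(1,3) by auto
  ultimately obtain s where s: "s \<in> ?Z" "\<And>t. t \<in> ?Z \<Longrightarrow> t \<le> s"
    using compact_attains_sup[of ?Z] by blast
  have "\<tau> \<le> s" "s < T" "f s = 0"
    using s(1) fT by (auto simp: less_le)
  have pos: "0 < f t" if t: "s < t" "t < T" for t
  proof (rule ccontr)
    assume "\<not> 0 < f t"
    moreover have "continuous_on {t..T} f"
      using that \<open>\<tau> \<le> s\<close> by (auto intro: continuous_on_subset[OF cont])
    ultimately obtain z where "t \<le> z" "z \<le> T" "f z = 0"
      using IVT'[of f t 0 T] t fT by auto
    then show False
      using s(2)[of z] t \<open>\<tau> \<le> s\<close> by simp
  qed
  have cont': "continuous_on {s..t} f" if "t \<le> T" for t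
    using that \<open>\<tau> \<le> s\<close> by (auto intro: continuous_on_subset[OF cont])
  have "(\<forall>t\<in>{s<..<T}. \<exists>d\<le>0. (f has_real_derivative d) (at_right t)) \<or>
      (\<exists>c>0. eventually (\<lambda>t. \<exists>d\<ge>c. (f has_real_derivative d) (at_right t)) (at_right s))"
    by (rule dich[OF \<open>\<tau> \<le> s\<close> \<open>s < T\<close> \<open>f s = 0\<close>]; rule pos)
  then show False
  proof (elim disjE exE conjE)
    assume "\<forall>t\<in>{s<..<T}. \<exists>d\<le>0. (f has_real_derivative d) (at_right t)"
    then have "f T \<le> 0"
      using right_derivative_barrier[of s T f 0] \<open>s < T\<close> \<open>f s = 0\<close> cont'[of T] by auto
    with fT show False by simp
  next
    fix c :: real
    assume "0 < c" "eventually (\<lambda>t. \<exists>d\<ge>c. (f has_real_derivative d) (at_right t)) (at_right s)"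
    then obtain r where r: "s < r" "\<And>t. s < t \<Longrightarrow> t < r \<Longrightarrow> \<exists>d\<ge>c. (f has_real_derivative d) (at_right t)"
      by (auto simp: eventually_at_right_field)
    \<comment> \<open>The barrier for \<open>c * (t - s) - f t\<close> integrates the lower bound on
      later derivatives. The difference quotients at \<open>s\<close> are then at least
      \<open>c\<close>, against the right derivative 0 there.\<close>
    have growth: "c * (t - s) \<le> f t" if t: "s < t" "t < r" "t < T" for t
    proof -
      have "c * (t - s) - f t \<le> 0"
      proof (rule right_derivative_barrier[where s = s and T = t and f = "\<lambda>t. c * (t - s) - f t"])
        show "continuous_on {s..t} (\<lambda>t. c * (t - s) - f t)"
          using that by (intro continuous_intros cont') simp
        fix u assume "s < u" "u < t"
        then obtain d where d: "d \<ge> c" "(f has_real_derivative d) (at_right u)"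
          using r(2)[of u] t \<open>s < u\<close> \<open>u < t\<close> by fastforce
        have "((\<lambda>t. c * (t - s) - f t) has_real_derivative c - d) (at_right u)"
          by (rule derivative_eq_intros d(2) refl | simp)+
        then show "\<exists>d\<le>0. ((\<lambda>t. c * (t - s) - f t) has_real_derivative d) (at_right u)"
          using d(1) by (intro exI[of _ "c - d"]) simp
      qed (use that \<open>f s = 0\<close> in auto)
      then show ?thesis by simp
    qed
    have "((\<lambda>t. (f t - f s) / (t - s)) \<longlongrightarrow> 0) (at_right s)"
      using deriv[OF \<open>\<tau> \<le> s\<close> \<open>s < T\<close> \<open>f s = 0\<close>] by (simp add: has_field_derivative_iff)
    moreover have "eventually (\<lambda>t. c \<le> (f t - f s) / (t - s)) (at_right s)"
      unfolding eventually_at_right_field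
      using growth \<open>s < r\<close> \<open>s < T\<close> \<open>f s = 0\<close>
      by (intro exI[of _ "min r T"]) (simp add: pos_le_divide_eq)
    ultimately have "c \<le> 0"
      by (intro tendsto_lowerbound) auto
    with \<open>0 < c\<close> show False by simp
  qed
qed

section \<open>The potential of the max-price\<close>

locale auction = real_distribution M for M :: "real measure" +
  fixes p :: real
  assumes support: "measure M {0..1} = 1" and p_pos: "0 < p" and p_less: "p < 1"
begin

abbreviation F :: "real \<Rightarrow> real" where "F \<equiv> cdf M"
abbreviation F_minus :: "real \<Rightarrow> real" where "F_minus \<equiv> cdf_minus M"
abbreviation q0 :: real where "q0 \<equiv> quantile M p"

section \<open>One-sided limits of the distribution function, and the quantile\<close>

lemma cdf_minus_eq: "F_minus x = measure M {..<x}"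
  unfolding cdf_minus_def by (intro tendsto_Lim cdf_at_left) simp

lemma cdf_minus_mono: "x \<le> y \<Longrightarrow> F_minus x \<le> F_minus y"
  unfolding cdf_minus_eq by (intro finite_measure_mono) auto

lemma cdf_minus_le: "x \<le> y \<Longrightarrow> F_minus x \<le> F y"
  unfolding cdf_minus_eq cdf_def by (intro finite_measure_mono) auto

lemma cdf_le_minus: "x < y \<Longrightarrow> F x \<le> F_minus y"
  unfolding cdf_minus_eq cdf_def by (intro finite_measure_mono) auto

lemma cdf_minus_cdf_minus: "a \<le> b \<Longrightarrow> F b - F_minus a = measure M {a..b}"
proof -
  assume "a \<le> b"
  then have "{..b} = {..<a} \<union> {a..b}" by auto
  then have "measure M {..b} = measure M {..<a} + measure M {a..b}"
    by (simp add: finite_measure_Union ivl_disj_int)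
  then show ?thesis
    unfolding cdf_minus_eq cdf_def by simp
qed

text \<open>The weak inequality admits paths that rest at \<open>x\<close>, which an end point of
  the price window may do; a limit along \<open>at_right x\<close> would exclude them.\<close>

lemma tendsto_cdf_right:
  assumes "(b \<longlongrightarrow> x) Fl" and "eventually (\<lambda>s. x \<le> b s) Fl"
  shows "((\<lambda>s. F (b s)) \<longlongrightarrow> F x) Fl"
proof -
  have "continuous (at x within {x..}) F"
    using cdf_is_right_cont[of x] at_within_Ici_at_right[of x] by simp
  from continuous_within_tendsto_compose[OF this _ assms(1)] assms(2) show ?thesis
    by simp
qed

text \<open>As \<open>F_minus x\<close> is the left limit of \<open>F\<close>, some
  \<open>z < x\<close> has \<open>F z\<close> above any given value below \<open>F_minus x\<close>;
  once \<open>b s\<close> exceeds \<open>z\<close>, \<open>F_minus (b s)\<close> is at least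
  \<open>F z\<close>. The upper bound is monotonicity.\<close>

lemma tendsto_cdf_minus_left:
  assumes "(b \<longlongrightarrow> x) Fl" and "eventually (\<lambda>s. b s \<le> x) Fl"
  shows "((\<lambda>s. F_minus (b s)) \<longlongrightarrow> F_minus x) Fl"
proof (rule order_tendstoI)
  fix y assume "y < F_minus x"
  then have "eventually (\<lambda>z. y < F z) (at_left x)"
    using order_tendstoD(1)[OF cdf_at_left[of x]] unfolding cdf_minus_eq by blast
  moreover have "eventually (\<lambda>z. z < x) (at_left x)"
    by (simp add: eventually_at_filter)
  ultimately have "eventually (\<lambda>z. y < F z \<and> z < x) (at_left x)"
    by (rule eventually_conj)
  then obtain z where z: "y < F z" "z < x"
    using eventually_happens' trivial_limit_at_left_real by blast
  show "eventually (\<lambda>s. y < F_minus (b s)) Fl"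
    using order_tendstoD(1)[OF assms(1) z(2)]
  proof eventually_elim
    case (elim s) then show ?case using cdf_le_minus[of z "b s"] z(1) by simp
  qed
next
  fix y assume "F_minus x < y"
  with assms(2) show "eventually (\<lambda>s. F_minus (b s) < y) Fl"
    by (auto elim!: eventually_mono intro: le_less_trans[OF cdf_minus_mono])
qed

lemma AE_support: "AE z in M. z \<in> {0..1}"
  using support AE_prob_1 by blast

lemma cdf_minus_bounds: "0 \<le> F_minus x" "F_minus x \<le> 1"
  by (simp_all add: cdf_minus_eq)

lemma cdf_minus_nonpos: "x \<le> 0 \<Longrightarrow> F_minus x = 0"
proof -
  assume "x \<le> 0"
  then have "measure M {..<x} + measure M {0..1} = measure M ({..<x} \<union> {0..1})"
    by (subst finite_measure_Union) auto
  also have "\<dots> \<le> 1" by simp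
  finally show ?thesis
    using support cdf_minus_bounds[of x] unfolding cdf_minus_eq by linarith
qed

lemma cdf_neg: "x < 0 \<Longrightarrow> F x = 0"
  using cdf_le_minus[of x 0] cdf_minus_nonpos[of 0] cdf_nonneg[of x] by simp

lemma cdf_ge_1: "1 \<le> x \<Longrightarrow> F x = 1"
proof -
  assume "1 \<le> x"
  then have "measure M {0..1} \<le> F x"
    unfolding cdf_def by (intro finite_measure_mono) auto
  then show ?thesis
    using support cdf_bounded_prob[of x] by simp
qed

lemma quantile_bounds: "0 \<le> q0" "q0 \<le> 1"
proof -
  have 1: "1 \<in> {x. 0 \<le> x \<and> p \<le> F x}"
    using cdf_ge_1[of 1] p_less by auto
  then show "0 \<le> q0"
    unfolding quantile_def by (intro cInf_greatest) (use 1 in blast, simp)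
  show "q0 \<le> 1"
    unfolding quantile_def by (intro cInf_lower 1 bdd_belowI[of _ 0]) auto
qed

lemma cdf_less_p: "x < q0 \<Longrightarrow> F x < p"
proof (rule ccontr)
  assume x: "x < q0" and "\<not> F x < p"
  moreover from this have "0 \<le> x"
    using cdf_neg[of x] p_pos by force
  ultimately have "q0 \<le> x"
    unfolding quantile_def by (intro cInf_lower bdd_belowI[of _ 0]) auto
  with x show False by simp
qed

lemma p_le_cdf: "q0 \<le> x \<Longrightarrow> p \<le> F x"
proof -
  \<comment> \<open>Right continuity of \<open>F\<close> makes the infimum in
    \<open>quantile\<close> attained.\<close>
  have "p \<le> F q0"
  proof (rule tendsto_lowerbound)
    show "(F \<longlongrightarrow> F q0) (at_right q0)"
      using cdf_is_right_cont[of q0] by (simp add: continuous_within)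
    have "p \<le> F y" if y: "q0 < y" for y
    proof -
      have "1 \<in> {x. 0 \<le> x \<and> p \<le> F x}"
        using cdf_ge_1[of 1] p_less by auto
      then obtain z where "z < y" "p \<le> F z"
        using cInf_lessD[of "{x. 0 \<le> x \<and> p \<le> F x}" y] y
        unfolding quantile_def by blast
      then show ?thesis
        using cdf_nondecreasing[of z y] by simp
    qed
    then show "eventually (\<lambda>y. p \<le> F y) (at_right q0)"
      by (simp add: eventually_at_right_field) (meson gt_ex)
  qed simp
  then show "q0 \<le> x \<Longrightarrow> p \<le> F x"
    using cdf_nondecreasing by force
qed

lemma cdf_minus_le_p: "x \<le> q0 \<Longrightarrow> F_minus x \<le> p"
proof -
  have "F_minus q0 \<le> p"
    unfolding cdf_minus_eq
    by (rule tendsto_upperbound[OF cdf_at_left])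
      (auto simp: eventually_at_left_field intro!: exI[of _ "q0 - 1"] less_imp_le cdf_less_p)
  then show "x \<le> q0 \<Longrightarrow> F_minus x \<le> p"
    using cdf_minus_mono by force
qed

text \<open>This is the usual source of nonzero denominators: \<open>F\<close> stays strictly below
  \<open>p\<close> left of the quantile and reaches \<open>p\<close> at it.\<close>

lemma cdf_diff_pos:
  assumes "a < q0" and "q0 \<le> b"
  shows "0 < F b - F_minus a"
  using cdf_minus_le[of a a] cdf_less_p[OF assms(1)] p_le_cdf[OF assms(2)] by simp

section \<open>The convex potential and its one-sided slopes\<close>

definition G :: "real \<Rightarrow> real" where
  "G x = (LINT z|M. max (x - z) 0) - p * x"

lemma integrable_pos_part: "integrable M (\<lambda>z. max (x - z) 0)"
proof (rule integrable_const_bound)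
  show "AE z in M. norm (max (x - z) 0) \<le> \<bar>x\<bar> + 1"
    using AE_support by eventually_elim auto
qed simp

lemma integrable_indicator_Icc: "integrable M (\<lambda>z. indicator {a..b} z * z)"
proof (rule integrable_const_bound)
  show "AE z in M. norm (indicator {a..b} z * z) \<le> 1"
    using AE_support by eventually_elim (auto simp: indicator_def)
qed simp

lemma G_diff:
  "G y - G x = (LINT z|M. max (y - z) 0 - max (x - z) 0) - p * (y - x)"
  unfolding G_def by (simp add: integrable_pos_part algebra_simps)

text \<open>From \<open>x\<close> to \<open>y\<close> the positive part gains the full
  \<open>y - x\<close> for every \<open>z \<le> x\<close> and never decreases for the
  others.\<close>

lemma G_slope_ge:
  assumes "x \<le> y"
  shows "(F x - p) * (y - x) \<le> G y - G x"
proof -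
  have "(y - x) * F x = (LINT z|M. indicator {..x} z * (y - x))"
    by (simp add: cdf_def)
  also have "\<dots> \<le> (LINT z|M. max (y - z) 0 - max (x - z) 0)"
    using assms by (intro integral_mono Bochner_Integration.integrable_diff integrable_pos_part)
      (auto simp: emeasure_eq_measure intro!: integrable_mult_left integrable_real_indicator
        split: split_indicator)
  finally show ?thesis
    unfolding G_diff by (simp add: algebra_simps)
qed

text \<open>The positive part gains at most \<open>y - x\<close>, and nothing for
  \<open>z \<ge> y\<close>, so only the mass strictly left of \<open>y\<close> counts.\<close>

lemma G_slope_le:
  assumes "x \<le> y"
  shows "G y - G x \<le> (F_minus y - p) * (y - x)"
proof -
  have "(LINT z|M. max (y - z) 0 - max (x - z) 0) \<le> (LINT z|M. indicator {..<y} z * (y - x))"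
    using assms by (intro integral_mono Bochner_Integration.integrable_diff integrable_pos_part)
      (auto simp: emeasure_eq_measure intro!: integrable_mult_left integrable_real_indicator
        split: split_indicator)
  also have "\<dots> = (y - x) * F_minus y"
    by (simp add: cdf_minus_eq)
  finally show ?thesis
    unfolding G_diff by (simp add: algebra_simps)
qed

text \<open>The positive part gains \<open>b - a\<close> left of \<open>a\<close>,
  \<open>b - z\<close> on \<open>{a..b}\<close> and nothing beyond; the middle range contributes the
  integral in the numerator of the barycenter.\<close>

lemma G_diff_barycenter:
  assumes "a \<le> b"
  shows "G b - G a = b * F b - a * F_minus a - (LINT z:{a..b}|M. z) - p * (b - a)"
proof -
  have "max (b - z) 0 - max (a - z) 0 =
      indicator {..<a} z * (b - a) + (indicator {a..b} z * b - indicator {a..b} z * z)" for z :: real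
    using assms by (auto simp: indicator_def)
  then have "(LINT z|M. max (b - z) 0 - max (a - z) 0) =
      (LINT z|M. indicator {..<a} z * (b - a) + (indicator {a..b} z * b - indicator {a..b} z * z))"
    by presburger
  also have "\<dots> = (LINT z|M. indicator {..<a} z * (b - a)) +
      ((LINT z|M. indicator {a..b} z * b) - (LINT z|M. indicator {a..b} z * z))"
    by (subst Bochner_Integration.integral_add Bochner_Integration.integral_diff;
        (intro Bochner_Integration.integrable_diff integrable_indicator_Icc
          integrable_mult_left integrable_real_indicator)?;
        simp add: emeasure_eq_measure)+
  also have "\<dots> = F_minus a * (b - a) + (F b - F_minus a) * b - (LINT z:{a..b}|M. z)"
    using cdf_minus_cdf_minus[OF assms] by (simp add: cdf_minus_eq set_lebesgue_integral_def)
  finally show ?thesis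
    unfolding G_diff by (simp add: algebra_simps)
qed

lemma G_mono:
  assumes "q0 \<le> x" and "x \<le> y"
  shows "G x \<le> G y"
proof -
  have "0 \<le> (F x - p) * (y - x)"
    using p_le_cdf[OF assms(1)] assms(2) by simp
  then show ?thesis
    using G_slope_ge[OF assms(2)] by linarith
qed

lemma G_strict_antimono:
  assumes "x < y" and "y \<le> q0"
  shows "G y < G x"
proof -
  \<comment> \<open>If \<open>y = q0\<close>, then \<open>F_minus y\<close> may equal
    \<open>p\<close>. The midpoint lies strictly left of the quantile, so the first half of the
    interval gives the strict decrease.\<close>
  define m where "m = (x + y) / 2"
  have m: "x < m" "m < y" "m < q0"
    using assms by (auto simp: m_def)
  have "F_minus m < p"
    using cdf_minus_le[of m m] cdf_less_p[OF m(3)] by simp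
  then have "(F_minus m - p) * (m - x) < 0"
    using m(1) by (intro mult_neg_pos) auto
  moreover have "(F_minus y - p) * (y - m) \<le> 0"
    using cdf_minus_le_p[OF assms(2)] m(2) by (intro mult_nonpos_nonneg) auto
  ultimately show ?thesis
    using G_slope_le[of x m] G_slope_le[of m y] m by linarith
qed

lemma G_lipschitz: "\<bar>G y - G x\<bar> \<le> \<bar>y - x\<bar>"
proof -
  have *: "\<bar>G y - G x\<bar> \<le> y - x" if "x \<le> y" for x y
  proof -
    have "(F_minus y - p) * (y - x) \<le> 1 * (y - x)"
      using cdf_minus_bounds[of y] p_pos that by (intro mult_right_mono) auto
    moreover have "(-1) * (y - x) \<le> (F x - p) * (y - x)"
      using cdf_nonneg[of x] p_less that by (intro mult_right_mono) auto
    ultimately show ?thesis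
      using order_trans[OF G_slope_le[OF that]] order_trans[OF _ G_slope_ge[OF that]]
      by (fastforce simp: abs_le_iff)
  qed
  show ?thesis
    using *[of x y] *[of y x] by (cases "x \<le> y") (auto simp: abs_minus_commute)
qed

lemma continuous_on_G: "continuous_on UNIV G"
  unfolding continuous_on_iff dist_real_def
  using G_lipschitz by (metis order_le_less_trans)

text \<open>The increment is written as a product because \<open>b s\<close> may equal
  \<open>x\<close>, where a quotient is undefined; \<open>\<phi>\<close> then takes the limiting
  slope as its default. Elsewhere convexity squeezes it between \<open>F x - p\<close> and
  \<open>F (b s) - p\<close>.\<close>

lemma G_right_slope:
  assumes "(b \<longlongrightarrow> x) Fl" and "eventually (\<lambda>s. x \<le> b s) Fl"
  obtains \<phi> where "(\<phi> \<longlongrightarrow> F x - p) Fl"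
    and "eventually (\<lambda>s. G (b s) - G x = \<phi> s * (b s - x)) Fl"
proof
  define \<phi> where "\<phi> s = (if b s = x then F x - p else (G (b s) - G x) / (b s - x))" for s
  show "eventually (\<lambda>s. G (b s) - G x = \<phi> s * (b s - x)) Fl"
    by (simp add: \<phi>_def)
  have *: "F x - p \<le> \<phi> s \<and> \<phi> s \<le> F (b s) - p" if "x \<le> b s" for s
  proof (cases "b s = x")
    case False
    then have "0 < b s - x" using that by simp
    moreover have "G (b s) - G x \<le> (F (b s) - p) * (b s - x)"
      using that cdf_minus_le[of "b s" "b s"]
      by (intro order_trans[OF G_slope_le[OF that]] mult_right_mono) auto
    ultimately show ?thesis
      using False G_slope_ge[OF that]
      by (simp add: \<phi>_def pos_le_divide_eq pos_divide_le_eq)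
  qed (simp add: \<phi>_def)
  show "(\<phi> \<longlongrightarrow> F x - p) Fl"
  proof (rule tendsto_sandwich)
    show "eventually (\<lambda>s. F x - p \<le> \<phi> s) Fl" "eventually (\<lambda>s. \<phi> s \<le> F (b s) - p) Fl"
      using assms(2) by (auto elim!: eventually_mono dest: *)
    show "((\<lambda>s. F (b s) - p) \<longlongrightarrow> F x - p) Fl"
      by (intro tendsto_intros tendsto_cdf_right assms)
  qed simp
qed

lemma G_left_slope:
  assumes "(a \<longlongrightarrow> x) Fl" and "eventually (\<lambda>s. a s \<le> x) Fl"
  obtains \<psi> where "(\<psi> \<longlongrightarrow> F_minus x - p) Fl"
    and "eventually (\<lambda>s. G (a s) - G x = \<psi> s * (a s - x)) Fl"
proof
  define \<psi> where "\<psi> s = (if a s = x then F_minus x - p else (G x - G (a s)) / (x - a s))" for s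
  have "G (a s) - G x = \<psi> s * (a s - x)" for s
    by (cases "a s = x") (simp_all add: \<psi>_def field_simps)
  then show "eventually (\<lambda>s. G (a s) - G x = \<psi> s * (a s - x)) Fl"
    by simp
  have *: "F_minus (a s) - p \<le> \<psi> s \<and> \<psi> s \<le> F_minus x - p" if "a s \<le> x" for s
  proof (cases "a s = x")
    case False
    then have "0 < x - a s" using that by simp
    moreover have "(F_minus (a s) - p) * (x - a s) \<le> G x - G (a s)"
      using that cdf_minus_le[of "a s" "a s"]
      by (intro order_trans[OF _ G_slope_ge[OF that]] mult_right_mono) auto
    ultimately show ?thesis
      using False G_slope_le[OF that]
      by (simp add: \<psi>_def pos_le_divide_eq pos_divide_le_eq)
  qed (simp add: \<psi>_def)
  show "(\<psi> \<longlongrightarrow> F_minus x - p) Fl"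
  proof (rule tendsto_sandwich)
    show "eventually (\<lambda>s. F_minus (a s) - p \<le> \<psi> s) Fl"
      "eventually (\<lambda>s. \<psi> s \<le> F_minus x - p) Fl"
      using assms(2) by (auto elim!: eventually_mono dest: *)
    show "((\<lambda>s. F_minus (a s) - p) \<longlongrightarrow> F_minus x - p) Fl"
      by (intro tendsto_intros tendsto_cdf_minus_left assms)
  qed simp
qed

section \<open>The equation\<close>


text \<open>Equality of the potentials alone would not single out \<open>x\<close>, as
  \<open>G\<close> may be flat to the right of the quantile; hence the two inequalities.\<close>

definition balanced :: "real \<Rightarrow> real \<Rightarrow> bool" where
  "balanced t x \<longleftrightarrow> G (x + t) = G (x - t) \<and> x - t \<le> q0 \<and> q0 \<le> x + t"

text \<open>By \<open>G_diff_barycenter\<close>, the difference of the two sides multiplied by the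
  denominator is \<open>G (x + t) - G (x - t)\<close>.\<close>

lemma equation_iff_G_eq:
  assumes "0 \<le> t" and D: "F (x + t) - F_minus (x - t) \<noteq> 0"
  shows "x = barycenter M (x - t) (x + t) +
      t * ((p - F_minus (x - t) - (F (x + t) - p)) / (F (x + t) - F_minus (x - t)))
    \<longleftrightarrow> G (x + t) = G (x - t)"
proof -
  let ?D = "F (x + t) - F_minus (x - t)" and ?I = "LINT z:{x - t..x + t}|M. z"
  let ?N = "p - F_minus (x - t) - (F (x + t) - p)"
  have "G (x + t) - G (x - t) = x * ?D - (?I + t * ?N)"
    using G_diff_barycenter[of "x - t" "x + t"] assms(1) by (simp add: algebra_simps)
  moreover have "x = barycenter M (x - t) (x + t) + t * (?N / ?D) \<longleftrightarrow> x * ?D = ?I + t * ?N"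
    using D unfolding barycenter_def by (simp add: add_divide_distrib[symmetric] eq_divide_eq)
  ultimately show ?thesis by auto
qed

text \<open>Moving the window to the right strictly lowers \<open>G\<close> at its lower end and
  does not lower it at its upper end, so equality cannot persist.\<close>

lemma balanced_unique:
  assumes "balanced t x" and "balanced t y"
  shows "x = y"
proof -
  have "\<not> x < y" if "balanced t x" "balanced t y" for x y
  proof
    assume "x < y"
    then have "G (y - t) < G (x - t)" "G (x + t) \<le> G (y + t)"
      using that unfolding balanced_def by (intro G_strict_antimono G_mono; simp)+
    with that show False
      unfolding balanced_def by simp
  qed
  from this[of x y] this[of y x] assms show ?thesis by auto
qed

text \<open>If one end of the longer window moved inwards, its other end would move outwards, and
  \<open>G\<close> would change in opposite directions at the two ends, strictly at the lower
  one.\<close>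

lemma balanced_mono:
  assumes "balanced s x" and "balanced t y" and "s \<le> t"
  shows "x + s \<le> y + t" and "y - t \<le> x - s"
proof -
  show "x + s \<le> y + t"
  proof (rule ccontr)
    assume "\<not> x + s \<le> y + t"
    then have "G (x - s) < G (y - t)" "G (y + t) \<le> G (x + s)"
      using assms unfolding balanced_def by (intro G_strict_antimono G_mono; simp)+
    with assms show False
      unfolding balanced_def by simp
  qed
  show "y - t \<le> x - s"
  proof (rule ccontr)
    assume "\<not> y - t \<le> x - s"
    then have "G (y - t) < G (x - s)" "G (x + s) \<le> G (y + t)"
      using assms unfolding balanced_def by (intro G_strict_antimono G_mono; simp)+
    with assms show False
      unfolding balanced_def by simp
  qed
qed

lemma balanced_exists:
  assumes "0 \<le> t"
  shows "\<exists>x. balanced t x"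
proof -
  let ?h = "\<lambda>x. G (x + t) - G (x - t)"
  \<comment> \<open>The two extreme positions put the upper, respectively the lower, end of the
    window at the quantile.\<close>
  have "?h (q0 - t) \<le> 0"
    using G_strict_antimono[of "q0 - 2 * t" q0] assms by (cases "t = 0") auto
  moreover have "0 \<le> ?h (q0 + t)"
    using G_mono[of q0 "q0 + 2 * t"] assms by (simp add: add.commute)
  moreover have "continuous_on {q0 - t..q0 + t} ?h"
    by (intro continuous_intros continuous_on_compose2[OF continuous_on_G]) auto
  ultimately obtain x where "q0 - t \<le> x" "x \<le> q0 + t" "?h x = 0"
    using IVT'[of ?h "q0 - t" 0 "q0 + t"] assms by auto
  then show ?thesis
    unfolding balanced_def by (intro exI[of _ x]) auto
qed

lemma continuous_on_of_balanced:
  assumes "\<And>t. 0 \<le> t \<Longrightarrow> balanced t (q t)"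
  shows "continuous_on {0..} q"
proof -
  \<comment> \<open>Both end points move outwards, which bounds the displacement of the centre by
    the elapsed time.\<close>
  have *: "\<bar>q t - q s\<bar> \<le> \<bar>t - s\<bar>" if "0 \<le> s" "0 \<le> t" for s t
    using balanced_mono[OF assms assms, of s t] balanced_mono[OF assms assms, of t s] that
    by (cases "s \<le> t") auto
  show ?thesis
    unfolding continuous_on_iff dist_real_def using * by (meson atLeast_iff le_less_trans)
qed

text \<open>Inside a flat piece of \<open>G\<close> the denominator of the equation is nonzero only if the upper end point is
  the right end of the piece. As that pins \<open>q t + t\<close>, a continuous solution of the equation cannot
  get there from the quantile.\<close>

lemma plateau_right_end:
  assumes "0 < t" and G_eq: "G (x + t) = G (x - t)"
    and D: "F (x + t) - F_minus (x - t) \<noteq> 0" and above: "q0 < x - t"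
  shows "y < x + t \<Longrightarrow> F y \<le> p" and "p < F (x + t)"
proof -
  have *: "F y \<le> p" if "x - t \<le> y" "y < x + t" for y
  proof -
    have "(F y - p) * (x + t - y) \<le> G (x + t) - G y"
      using that by (intro G_slope_ge) simp
    also have "\<dots> \<le> 0"
      using G_mono[of "x - t" y] G_eq above that by simp
    finally show ?thesis
      using that by (simp add: mult_le_0_iff)
  qed
  show "y < x + t \<Longrightarrow> F y \<le> p"
    using *[of "max y (x - t)"] cdf_nondecreasing[of y "max y (x - t)"] \<open>0 < t\<close> by simp
  have "p \<le> F_minus (x - t)"
    using p_le_cdf[of q0] cdf_le_minus[OF above] by simp
  moreover have "F_minus (x - t) \<le> F (x + t)"
    using \<open>0 < t\<close> by (intro cdf_minus_le) simp
  ultimately show "p < F (x + t)"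
    using D by simp
qed

lemma equation_balanced:
  assumes sol: "solves_equation M p q" and "0 \<le> t"
  shows "balanced t (q t)"
proof (cases "t = 0")
  case True
  then show ?thesis
    using sol by (simp add: balanced_def solves_equation_def)
next
  case False
  have D: "F (q s + s) - F_minus (q s - s) \<noteq> 0" and G_eq: "G (q s + s) = G (q s - s)"
    if "0 < s" for s
    using sol that equation_iff_G_eq[of s "q s"] unfolding solves_equation_def by (auto simp: less_imp_le)
  have "q t - t \<le> q0"
  proof (rule ccontr)
    assume "\<not> q t - t \<le> q0"
    \<comment> \<open>Any intermediate level of the lower end would do; half of the excess
      \<open>c\<close> is attained at some earlier time \<open>s\<close>.\<close>
    define c where "c = q t - t - q0"
    have "0 < c" using \<open>\<not> q t - t \<le> q0\<close> by (simp add: c_def)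
    have "continuous_on {0..t} (\<lambda>s. q s - s)"
      using sol by (auto simp: solves_equation_def intro!: continuous_intros elim: continuous_on_subset)
    then obtain s where s: "0 \<le> s" "s \<le> t" "q s - s = q0 + c / 2"
      using IVT'[of "\<lambda>s. q s - s" 0 "q0 + c / 2" t] \<open>0 < c\<close> \<open>0 \<le> t\<close> sol
      by (auto simp: c_def solves_equation_def field_simps)
    have "0 < s"
      using s \<open>0 < c\<close> sol by (cases "s = 0") (auto simp: solves_equation_def)
    have "q0 < q s - s" "q0 < q t - t" "0 < t"
      using s(3) \<open>0 < c\<close> False \<open>0 \<le> t\<close> by (auto simp: c_def)
    \<comment> \<open>At both times the upper end is the point where \<open>F\<close> first exceeds
      \<open>p\<close>. If they differed, \<open>F\<close> would be both at most \<open>p\<close>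
      and above \<open>p\<close> at the smaller one.\<close>
    from plateau_right_end[OF \<open>0 < s\<close> G_eq D this(1)] plateau_right_end[OF this(3) G_eq D this(2)]
    have "\<not> q s + s < q t + t" "\<not> q t + t < q s + s"
      using \<open>0 < s\<close> \<open>0 < t\<close> by (auto simp: not_less[symmetric])
    then have "q s + s = q t + t" by simp
    then have "c / 2 = c + 2 * (t - s)"
      using s(3) by (simp add: c_def field_simps)
    then show False
      using s(2) \<open>0 < c\<close> by simp
  qed
  moreover have "q0 \<le> q t + t"
  proof (rule ccontr)
    assume "\<not> q0 \<le> q t + t"
    then have "G (q t + t) < G (q t - t)"
      using False \<open>0 \<le> t\<close> by (intro G_strict_antimono) auto
    then show False
      using G_eq[of t] False \<open>0 \<le> t\<close> by simp
  qed
  ultimately show ?thesis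
    using G_eq[of t] False \<open>0 \<le> t\<close> by (simp add: balanced_def)
qed

lemma equation_exists:
  assumes mass: "\<forall>x>q0. 0 < measure M {q0..x}"
  shows "\<exists>q. solves_equation M p q"
proof -
  define q where "q t = (SOME x. balanced t x)" for t
  have bal: "balanced t (q t)" if "0 \<le> t" for t
    unfolding q_def using someI_ex[OF balanced_exists[OF that]] .
  have q0: "q 0 = q0"
    using bal[of 0] by (simp add: balanced_def)
  \<comment> \<open>The lower end may rest at \<open>q0\<close> for positive \<open>t\<close>; the
    denominator is then the mass of a window starting at \<open>q0\<close>, which
    \<open>mass\<close> keeps positive.\<close>
  have D: "F (q t + t) - F_minus (q t - t) \<noteq> 0" if "0 < t" for t
  proof (cases "q t - t < q0")
    case True
    then show ?thesis
      using cdf_diff_pos[of "q t - t" "q t + t"] bal[of t] that by (auto simp: balanced_def)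
  next
    case False
    then have "q t - t = q0"
      using bal[of t] that by (simp add: balanced_def)
    then show ?thesis
      using mass cdf_minus_cdf_minus[of "q t - t" "q t + t"] that by (simp add: less_imp_neq[symmetric])
  qed
  have "solves_equation M p q"
    unfolding solves_equation_def
    using D bal continuous_on_of_balanced[of q] q0 equation_iff_G_eq[of _ "q _"]
    by (auto simp: balanced_def)
  then show ?thesis by blast
qed

lemma velocity_eq:
  "velocity M p q t = (2 * p - F_minus (q t - t) - F (q t + t)) / (F (q t + t) - F_minus (q t - t))"
  by (simp add: velocity_def winning_mass_def losing_mass_def)

lemma winning_plus_losing_mass:
  "winning_mass M p q t + losing_mass M p q t = F (q t + t) - F_minus (q t - t)"
  by (simp add: winning_mass_def losing_mass_def)

text \<open>The increments of \<open>G\<close> at the two ends agree. Factored through their slopes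
  \<open>\<phi>\<close> and \<open>\<psi>\<close>, this is a linear equation for the difference
  quotient of \<open>q\<close>, with leading coefficient \<open>\<phi> s - \<psi> s\<close> tending
  to the nonzero denominator.\<close>

lemma balanced_derivative:
  assumes bal: "\<And>t. 0 \<le> t \<Longrightarrow> balanced t (q t)" and "0 \<le> t"
    and D: "F (q t + t) - F_minus (q t - t) \<noteq> 0"
  shows "(q has_real_derivative velocity M p q t) (at_right t)"
proof -
  have "(q \<longlongrightarrow> q t) (at t within {0..})"
    using continuous_on_of_balanced[OF bal] \<open>0 \<le> t\<close> by (simp add: continuous_on_def)
  then have lim: "(q \<longlongrightarrow> q t) (at_right t)"
    by (rule tendsto_within_subset) (use \<open>0 \<le> t\<close> in auto)
  have gt: "eventually (\<lambda>s. t < s) (at_right t)"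
    by (simp add: eventually_at_filter)
  obtain \<phi> where \<phi>: "(\<phi> \<longlongrightarrow> F (q t + t) - p) (at_right t)"
    "eventually (\<lambda>s. G (q s + s) - G (q t + t) = \<phi> s * (q s + s - (q t + t))) (at_right t)"
  proof (rule G_right_slope)
    show "((\<lambda>s. q s + s) \<longlongrightarrow> q t + t) (at_right t)"
      by (intro tendsto_intros lim)
    show "eventually (\<lambda>s. q t + t \<le> q s + s) (at_right t)"
      using gt by eventually_elim (use balanced_mono(1)[OF bal bal] \<open>0 \<le> t\<close> in auto)
  qed
  obtain \<psi> where \<psi>: "(\<psi> \<longlongrightarrow> F_minus (q t - t) - p) (at_right t)"
    "eventually (\<lambda>s. G (q s - s) - G (q t - t) = \<psi> s * (q s - s - (q t - t))) (at_right t)"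
  proof (rule G_left_slope)
    show "((\<lambda>s. q s - s) \<longlongrightarrow> q t - t) (at_right t)"
      by (intro tendsto_intros lim)
    show "eventually (\<lambda>s. q s - s \<le> q t - t) (at_right t)"
      using gt by eventually_elim (use balanced_mono(2)[OF bal bal] \<open>0 \<le> t\<close> in auto)
  qed
  have diff: "((\<lambda>s. \<phi> s - \<psi> s) \<longlongrightarrow> F (q t + t) - F_minus (q t - t)) (at_right t)"
    using tendsto_diff[OF \<phi>(1) \<psi>(1)] by simp
  have "((\<lambda>s. - (\<phi> s + \<psi> s) / (\<phi> s - \<psi> s)) \<longlongrightarrow>
      - (F (q t + t) - p + (F_minus (q t - t) - p)) / (F (q t + t) - F_minus (q t - t))) (at_right t)"
    by (intro tendsto_divide tendsto_minus tendsto_add \<phi>(1) \<psi>(1) diff D)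
  then have "((\<lambda>s. - (\<phi> s + \<psi> s) / (\<phi> s - \<psi> s)) \<longlongrightarrow> velocity M p q t) (at_right t)"
    by (simp add: velocity_eq algebra_simps)
  moreover have "eventually (\<lambda>s. - (\<phi> s + \<psi> s) / (\<phi> s - \<psi> s) = (q s - q t) / (s - t)) (at_right t)"
    using gt \<phi>(2) \<psi>(2) tendsto_imp_eventually_ne[OF diff D]
  proof eventually_elim
    case (elim s)
    have "G (q s + s) - G (q t + t) = G (q s - s) - G (q t - t)"
      using bal[of s] bal[of t] elim(1) \<open>0 \<le> t\<close> by (simp add: balanced_def)
    then have "(q s - q t) * (\<phi> s - \<psi> s) = - (\<phi> s + \<psi> s) * (s - t)"
      unfolding elim(2,3) by (simp add: algebra_simps)
    then show ?case
      using elim by (simp add: frac_eq_eq)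
  qed
  ultimately show ?thesis
    unfolding has_field_derivative_iff by (rule Lim_transform_eventually)
qed

section \<open>The system\<close>


lemma stopped_solves_system:
  assumes sol: "solves_equation M p q"
  shows "solves_system M p (stopped_at_exit q)"
proof -
  have bal: "balanced t (q t)" if "0 \<le> t" for t
    using equation_balanced[OF sol that] .
  have D: "F (q t + t) - F_minus (q t - t) \<noteq> 0" if "0 < t" for t
    using sol that by (auto simp: solves_equation_def)
  have cont: "continuous_on {0..} q" and q_0: "q 0 = q0"
    using sol by (auto simp: solves_equation_def)
  let ?r = "stopped_at_exit q"
  let ?D = "\<lambda>t. F (?r t + t) - F_minus (?r t - t)"
  \<comment> \<open>Non-degeneracy, derivative and continuity share one case split: before the exit
    the stopped path agrees with \<open>q\<close> near \<open>t\<close>, afterwards it is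
    constant.\<close>
  have main: "(0 < t \<longrightarrow> ?D t \<noteq> 0) \<and> (?D t \<noteq> 0 \<longrightarrow>
      (?r has_real_derivative velocity M p ?r t * indicator {0<..<1} (?r t)) (at_right t))
      \<and> (?r \<longlongrightarrow> ?r t) (at t within {0..})"
    if "0 \<le> t" for t
    using cont
  proof (cases rule: first_exit[of q t])
    case 1
    then have qt: "?r t = q t" "q t \<in> {0<..<1}"
      using \<open>0 \<le> t\<close> by (auto intro: stopped_at_exit_inside)
    have "(q \<longlongrightarrow> q t) (at t within {0..})"
      using cont \<open>0 \<le> t\<close> by (simp add: continuous_on_def)
    then have "eventually (\<lambda>s. q s \<in> {0<..<1}) (at t within {0..})"
      by (rule topological_tendstoD) (use qt in auto)
    then obtain e where e: "e > 0"
      "\<And>s. 0 \<le> s \<Longrightarrow> s \<noteq> t \<Longrightarrow> dist s t < e \<Longrightarrow> q s \<in> {0<..<1}"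
      by (auto simp: eventually_at)
    have r_eq: "?r s = q s" if "0 \<le> s" "s < t + e" for s
    proof (intro stopped_at_exit_inside ballI)
      fix u assume "u \<in> {0..s}"
      then show "q u \<in> {0<..<1}"
        using 1 e(2)[of u] that by (cases "u \<le> t") (auto simp: dist_real_def)
    qed
    have "(?r has_real_derivative velocity M p ?r t * indicator {0<..<1} (?r t)) (at_right t)"
      if "?D t \<noteq> 0"
    proof -
      have "(q has_real_derivative velocity M p ?r t * indicator {0<..<1} (?r t)) (at_right t)"
        using balanced_derivative[OF bal \<open>0 \<le> t\<close>] that qt by (simp add: velocity_eq)
      moreover have "eventually (\<lambda>s. q s = ?r s) (at_right t)"
        unfolding eventually_at_right_field
        using e(1) \<open>0 \<le> t\<close> by (intro exI[of _ "t + e"]) (simp add: r_eq)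
      ultimately show ?thesis
        using qt(1) by (simp add: has_field_derivative_cong_eventually)
    qed
    moreover have "(?r \<longlongrightarrow> ?r t) (at t within {0..})"
    proof (rule Lim_transform_within[OF _ e(1)])
      show "(q \<longlongrightarrow> ?r t) (at t within {0..})"
        using qt(1) \<open>(q \<longlongrightarrow> q t) (at t within {0..})\<close> by simp
    qed (simp add: r_eq dist_real_def)
    ultimately show ?thesis
      using D[of t] qt(1) by simp
  next
    case (2 \<tau>)
    have r_eq: "?r s = q \<tau>" if "\<tau> \<le> s" for s
      using stopped_at_exit_outside[OF 2(1,3,4) that] .
    have "?D t \<noteq> 0" if "0 < t"
    proof (cases "\<tau> < t")
      case True
      \<comment> \<open>With the centre frozen at \<open>q \<tau>\<close>, the window keeps growing,
        so its lower end passes strictly below the quantile.\<close>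
      then have "q \<tau> - t < q0" "q0 \<le> q \<tau> + t"
        using bal[OF 2(1)] by (auto simp: balanced_def)
      then show ?thesis
        using cdf_diff_pos[of "q \<tau> - t" "q \<tau> + t"] r_eq[OF 2(2)] by simp
    next
      case False
      then show ?thesis
        using D[OF that] r_eq[of t] 2(2) by simp
    qed
    moreover have "(?r has_real_derivative velocity M p ?r t * indicator {0<..<1} (?r t)) (at_right t)"
    proof -
      have "eventually (\<lambda>s. q \<tau> = ?r s) (at_right t)"
        unfolding eventually_at_right_field
        using 2(2) by (intro exI[of _ "t + 1"]) (simp add: r_eq)
      then have "((\<lambda>_. q \<tau>) has_real_derivative 0) (at_right t) \<longleftrightarrow>
          (?r has_real_derivative 0) (at_right t)"
        using r_eq[OF 2(2)] by (intro has_field_derivative_cong_eventually) simp_all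
      then have "(?r has_real_derivative 0) (at_right t)"
        by simp
      then show ?thesis
        using 2(2,3) by (simp add: r_eq)
    qed
    moreover have "(?r \<longlongrightarrow> ?r t) (at t within {0..})"
    proof (rule Lim_transform_eventually)
      \<comment> \<open>Writing the stopped path as \<open>q (min s \<tau>)\<close> also covers
        \<open>t = \<tau>\<close>, where its two regimes meet.\<close>
      have "((\<lambda>s. min s \<tau>) \<longlongrightarrow> min t \<tau>) (at t within {0..})"
        by (intro tendsto_intros)
      moreover have "eventually (\<lambda>s. min s \<tau> \<in> {0..}) (at t within {0..})"
        using 2(1) by (auto simp: eventually_at_filter)
      ultimately have "((\<lambda>s. q (min s \<tau>)) \<longlongrightarrow> q (min t \<tau>)) (at t within {0..})"
        using cont 2(1) \<open>0 \<le> t\<close>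
        by (intro continuous_within_tendsto_compose[where S = "{0..}" and f = q])
          (auto simp: continuous_on_eq_continuous_within)
      then show "((\<lambda>s. q (min s \<tau>)) \<longlongrightarrow> ?r t) (at t within {0..})"
        using r_eq[OF 2(2)] 2(2) by (simp add: min_def split: if_splits)
      have "q (min s \<tau>) = ?r s" if "0 \<le> s" for s
        using that 2(4) r_eq[of s] stopped_at_exit_inside[of s q] by (cases "s < \<tau>") auto
      then show "eventually (\<lambda>s. q (min s \<tau>) = ?r s) (at t within {0..})"
        by (auto simp: eventually_at_filter)
    qed
    ultimately show ?thesis by simp
  qed
  have "?r 0 = q0"
    using q_0 stopped_at_exit_inside[of 0 q] stopped_at_exit_outside[of 0 q 0] by fastforce
  then show ?thesis
    unfolding solves_system_def winning_plus_losing_mass continuous_on_def using main by blast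
qed


text \<open>This is the speed of the lower end while the price moves; its sign depends only on
  comparing \<open>p\<close> with \<open>F\<close> at the upper end. The next lemma is the
  counterpart for the upper end.\<close>

lemma velocity_minus_1:
  "F (q t + t) - F_minus (q t - t) \<noteq> 0 \<Longrightarrow>
    velocity M p q t - 1 = 2 * (p - F (q t + t)) / (F (q t + t) - F_minus (q t - t))"
  unfolding velocity_eq by (simp add: field_simps)

lemma velocity_plus_1:
  "F (q t + t) - F_minus (q t - t) \<noteq> 0 \<Longrightarrow>
    velocity M p q t + 1 = 2 * (p - F_minus (q t - t)) / (F (q t + t) - F_minus (q t - t))"
  unfolding velocity_eq by (simp add: field_simps)

section \<open>A fixed solution of the system up to its exit\<close>

context
  fixes q :: "real \<Rightarrow> real"
  assumes sol: "solves_system M p q"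
begin

abbreviation speed :: "real \<Rightarrow> real" where
  "speed t \<equiv> velocity M p q t * indicator {0<..<1} (q t)"

lemma system_cont: "S \<subseteq> {0..} \<Longrightarrow> continuous_on S q"
  using sol by (auto simp: solves_system_def intro: continuous_on_subset)

lemma system_lim: "0 \<le> t \<Longrightarrow> (q \<longlongrightarrow> q t) (at_right t)"
  using system_cont[of "{0..}"]
  by (auto simp: continuous_on_def intro: tendsto_within_subset[where S = "{0..}"])

lemma system_start: "q 0 = q0"
  using sol by (simp add: solves_system_def)

lemma system_pos: "0 < t \<Longrightarrow> 0 < F (q t + t) - F_minus (q t - t)"
proof -
  assume "0 < t"
  then have "F (q t + t) - F_minus (q t - t) \<noteq> 0"
    using sol by (simp add: solves_system_def winning_plus_losing_mass)
  moreover have "F_minus (q t - t) \<le> F (q t + t)"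
    using \<open>0 < t\<close> by (intro cdf_minus_le) simp
  ultimately show ?thesis by simp
qed

lemma system_deriv_0:
  "0 \<le> t \<Longrightarrow> F (q t + t) - F_minus (q t - t) \<noteq> 0 \<Longrightarrow>
    (q has_real_derivative speed t) (at_right t)"
  using sol by (simp add: solves_system_def winning_plus_losing_mass)

lemma system_deriv: "0 < t \<Longrightarrow> (q has_real_derivative speed t) (at_right t)"
  using system_deriv_0[of t] system_pos[of t] by simp

lemma lower_deriv: "0 < t \<Longrightarrow> ((\<lambda>t. q t - t) has_real_derivative speed t - 1) (at_right t)"
  by (rule derivative_eq_intros system_deriv refl | assumption | simp)+

lemma upper_deriv: "0 < t \<Longrightarrow> ((\<lambda>t. - (q t + t)) has_real_derivative - (speed t + 1)) (at_right t)"
  by (rule derivative_eq_intros system_deriv refl | assumption | simp)+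

lemma speed_le_1:
  assumes "0 < t" "q0 \<le> q t + t"
  shows "speed t \<le> 1"
proof -
  have "2 * (p - F (q t + t)) / (F (q t + t) - F_minus (q t - t)) \<le> 0"
    using p_le_cdf[OF assms(2)] system_pos[OF assms(1)] by (intro divide_nonpos_pos) auto
  then have "velocity M p q t - 1 \<le> 0"
    using velocity_minus_1[of q t] system_pos[OF assms(1)] by simp
  then show ?thesis
    by (auto split: split_indicator)
qed

lemma speed_ge_minus_1:
  assumes "0 < t" "q t - t \<le> q0"
  shows "- 1 \<le> speed t"
proof -
  have "0 \<le> 2 * (p - F_minus (q t - t)) / (F (q t + t) - F_minus (q t - t))"
    using cdf_minus_le_p[OF assms(2)] system_pos[OF assms(1)] by (intro divide_nonneg_pos) auto
  then have "0 \<le> velocity M p q t + 1"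
    using velocity_plus_1[of q t] system_pos[OF assms(1)] by simp
  then show ?thesis
    by (auto split: split_indicator)
qed

text \<open>A lower end beyond the quantile forces the upper end beyond it too, so the speed is at
  most 1 and the lower end cannot advance; the barrier applies. The upper end is symmetric.\<close>

lemma system_straddles:
  assumes "0 \<le> t"
  shows "q t - t \<le> q0" and "q0 \<le> q t + t"
proof -
  show "q t - t \<le> q0"
  proof (rule right_derivative_barrier[OF assms, where f = "\<lambda>t. q t - t"])
    show "continuous_on {0..t} (\<lambda>t. q t - t)"
      by (intro continuous_intros system_cont) simp
    fix s assume "0 < s" "q0 < q s - s"
    then show "\<exists>d\<le>0. ((\<lambda>t. q t - t) has_real_derivative d) (at_right s)"
      using lower_deriv[of s] speed_le_1[of s] by (intro exI[of _ "speed s - 1"]) auto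
  qed (simp add: system_start)
  have "- (q t + t) \<le> - q0"
  proof (rule right_derivative_barrier[OF assms, where f = "\<lambda>t. - (q t + t)"])
    show "continuous_on {0..t} (\<lambda>t. - (q t + t))"
      by (intro continuous_intros system_cont) simp
    fix s assume "0 < s" "- q0 < - (q s + s)"
    then show "\<exists>d\<le>0. ((\<lambda>t. - (q t + t)) has_real_derivative d) (at_right s)"
      using upper_deriv[of s] speed_ge_minus_1[of s] by (intro exI[of _ "- (speed s + 1)"]) auto
  qed (simp add: system_start)
  then show "q0 \<le> q t + t" by simp
qed

text \<open>Once the window straddles the quantile, both speed bounds hold at every positive time,
  and the barrier can be placed at the value at time \<open>s\<close>.\<close>

lemma system_mono:
  assumes "0 \<le> s" and "s \<le> t"
  shows "q t - t \<le> q s - s" and "q s + s \<le> q t + t"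
proof -
  show "q t - t \<le> q s - s"
  proof (rule right_derivative_barrier[OF assms(2), where f = "\<lambda>t. q t - t"])
    show "continuous_on {s..t} (\<lambda>t. q t - t)"
      using assms by (intro continuous_intros system_cont) auto
    fix u assume "s < u"
    then show "\<exists>d\<le>0. ((\<lambda>t. q t - t) has_real_derivative d) (at_right u)"
      using lower_deriv[of u] speed_le_1[of u] system_straddles[of u] assms
      by (intro exI[of _ "speed u - 1"]) auto
  qed simp
  have "- (q t + t) \<le> - (q s + s)"
  proof (rule right_derivative_barrier[OF assms(2), where f = "\<lambda>t. - (q t + t)"])
    show "continuous_on {s..t} (\<lambda>t. - (q t + t))"
      using assms by (intro continuous_intros system_cont) auto
    fix u assume "s < u"
    then show "\<exists>d\<le>0. ((\<lambda>t. - (q t + t)) has_real_derivative d) (at_right u)"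
      using upper_deriv[of u] speed_ge_minus_1[of u] system_straddles[of u] assms
      by (intro exI[of _ "- (speed u + 1)"]) auto
  qed simp
  then show "q s + s \<le> q t + t" by simp
qed

text \<open>Outside the unit interval the indicator makes the speed zero, so 0 and 1 are
  barriers.\<close>

lemma system_range:
  assumes "0 \<le> t"
  shows "0 \<le> q t" and "q t \<le> 1"
proof -
  show "q t \<le> 1"
  proof (rule right_derivative_barrier[OF assms, where f = q])
    fix s assume "0 < s" "1 < q s"
    then show "\<exists>d\<le>0. (q has_real_derivative d) (at_right s)"
      using system_deriv[of s] by (intro exI[of _ 0]) simp
  qed (use quantile_bounds system_start in \<open>auto intro!: system_cont\<close>)
  have "- q t \<le> 0"
  proof (rule right_derivative_barrier[OF assms, where f = "\<lambda>t. - q t"])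
    fix s assume "0 < s" "0 < - q s"
    then show "\<exists>d\<le>0. ((\<lambda>t. - q t) has_real_derivative d) (at_right s)"
      using DERIV_minus[OF system_deriv[of s]] by (intro exI[of _ 0]) simp
  qed (use quantile_bounds system_start in \<open>auto intro!: system_cont continuous_intros\<close>)
  then show "0 \<le> q t" by simp
qed

text \<open>A chain rule with one-sided slopes: it works because \<open>system_mono\<close> moves
  each end point in the direction of the slope used there.\<close>

lemma G_difference_deriv:
  assumes "0 < t" and "q t \<in> {0<..<1}"
  shows "((\<lambda>s. G (q s + s) - G (q s - s)) has_real_derivative 0) (at_right t)"
proof -
  let ?D = "F (q t + t) - F_minus (q t - t)"
  have v: "(q has_real_derivative velocity M p q t) (at_right t)"
    using system_deriv[OF assms(1)] assms(2) by simp
  have lim: "(q \<longlongrightarrow> q t) (at_right t)"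
    using system_lim assms(1) by simp
  have gt: "eventually (\<lambda>s. t < s) (at_right t)"
    by (simp add: eventually_at_filter)
  have limq: "((\<lambda>s. (q s - q t) / (s - t)) \<longlongrightarrow> velocity M p q t) (at_right t)"
    using v by (simp add: has_field_derivative_iff)
  obtain \<phi> where \<phi>: "(\<phi> \<longlongrightarrow> F (q t + t) - p) (at_right t)"
    "eventually (\<lambda>s. G (q s + s) - G (q t + t) = \<phi> s * (q s + s - (q t + t))) (at_right t)"
  proof (rule G_right_slope)
    show "((\<lambda>s. q s + s) \<longlongrightarrow> q t + t) (at_right t)"
      by (intro tendsto_intros lim)
    show "eventually (\<lambda>s. q t + t \<le> q s + s) (at_right t)"
      using gt by eventually_elim (use system_mono(2) assms in auto)
  qed
  obtain \<psi> where \<psi>: "(\<psi> \<longlongrightarrow> F_minus (q t - t) - p) (at_right t)"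
    "eventually (\<lambda>s. G (q s - s) - G (q t - t) = \<psi> s * (q s - s - (q t - t))) (at_right t)"
  proof (rule G_left_slope)
    show "((\<lambda>s. q s - s) \<longlongrightarrow> q t - t) (at_right t)"
      by (intro tendsto_intros lim)
    show "eventually (\<lambda>s. q s - s \<le> q t - t) (at_right t)"
      using gt by eventually_elim (use system_mono(1) assms in auto)
  qed
  have "((\<lambda>s. \<phi> s * ((q s - q t) / (s - t) + 1) - \<psi> s * ((q s - q t) / (s - t) - 1)) \<longlongrightarrow>
      (F (q t + t) - p) * (velocity M p q t + 1) - (F_minus (q t - t) - p) * (velocity M p q t - 1))
      (at_right t)"
    by (intro tendsto_intros \<phi>(1) \<psi>(1) limq)
  moreover have "?D \<noteq> 0"
    using system_pos[OF assms(1)] by simp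
  \<comment> \<open>Each product is a slope at one end times the speed of that end; both equal
    \<open>2 * (F (q t + t) - p) * (p - F_minus (q t - t))\<close> over the denominator.\<close>
  then have "(F (q t + t) - p) * (velocity M p q t + 1)
      - (F_minus (q t - t) - p) * (velocity M p q t - 1) = 0"
    using velocity_minus_1[of q t] velocity_plus_1[of q t] by (simp add: field_simps)
  ultimately have "((\<lambda>s. \<phi> s * ((q s - q t) / (s - t) + 1) - \<psi> s * ((q s - q t) / (s - t) - 1))
      \<longlongrightarrow> 0) (at_right t)"
    by simp
  moreover have "eventually (\<lambda>s. \<phi> s * ((q s - q t) / (s - t) + 1) - \<psi> s * ((q s - q t) / (s - t) - 1)
      = (G (q s + s) - G (q s - s) - (G (q t + t) - G (q t - t))) / (s - t)) (at_right t)"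
    using gt \<phi>(2) \<psi>(2)
  proof eventually_elim
    case (elim s)
    have *: "G (q s + s) - G (q s - s) - (G (q t + t) - G (q t - t))
        = \<phi> s * (q s + s - (q t + t)) - \<psi> s * (q s - s - (q t - t))"
      unfolding elim(2,3)[symmetric] by simp
    have **: "(q s - q t) / (s - t) + 1 = (q s + s - (q t + t)) / (s - t)"
      "(q s - q t) / (s - t) - 1 = (q s - s - (q t - t)) / (s - t)"
      using elim(1) by (simp_all add: field_simps)
    show ?case
      unfolding * ** by (simp only: times_divide_eq_right
        diff_divide_distrib[of "\<phi> s * _" "\<psi> s * _"])
  qed
  ultimately show ?thesis
    unfolding has_field_derivative_iff by (rule Lim_transform_eventually)
qed

text \<open>The potential difference starts at 0, and the barrier applies to it and to its negative.
  The half-open range of \<open>inside\<close> lets the result reach the exit time itself.\<close>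

lemma system_balanced:
  assumes "0 \<le> t" and inside: "\<forall>s\<in>{0..<t}. q s \<in> {0<..<1}"
  shows "balanced t (q t)"
proof -
  let ?K = "\<lambda>s. G (q s + s) - G (q s - s)"
  have cont: "continuous_on {0..t} ?K"
    by (intro continuous_intros continuous_on_compose2[OF continuous_on_G] system_cont) auto
  have K: "(?K has_real_derivative 0) (at_right s)" if "0 < s" "s < t" for s
    using inside that by (intro G_difference_deriv) auto
  have "?K t \<le> 0"
    by (rule right_derivative_barrier[OF assms(1) cont])
      (auto intro!: exI[of _ 0] K)
  moreover have "- ?K t \<le> 0"
    using DERIV_minus[OF K]
    by (intro right_derivative_barrier[OF assms(1) continuous_on_minus[OF cont]] exI[of _ 0])
      auto
  ultimately show ?thesis
    using system_straddles[OF assms(1)] by (simp add: balanced_def)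
qed

section \<open>Behaviour at and after the exit\<close>

lemma system_deriv_outside:
  assumes "0 \<le> t" and "q t \<notin> {0<..<1}"
  shows "(q has_real_derivative 0) (at_right t)"
proof -
  have "F (q t + t) - F_minus (q t - t) \<noteq> 0"
  proof (cases "t = 0")
    case True
    \<comment> \<open>A quantile at an end of the unit interval carries an atom, which makes the
      denominator nonzero even at time 0.\<close>
    have "q0 = 0 \<or> q0 = 1"
      using assms True quantile_bounds system_start by auto
    then show ?thesis
      using True system_start p_le_cdf[of q0] cdf_minus_nonpos[of 0] cdf_minus_le_p[of q0]
        cdf_ge_1[of 1] p_pos p_less by auto
  next
    case False
    then show ?thesis
      using system_pos[of t] assms by simp
  qed
  from system_deriv_0[OF assms(1) this] show ?thesis
    using assms(2) by simp
qed

text \<open>With no mass below the window the velocity is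
  \<open>(2 * p - F (q t + t)) / F (q t + t)\<close>, so \<open>F s\<close> decides the alternative
  in \<open>no_departure\<close>: from \<open>2 * p\<close> on the price cannot rise, and below it
  the speed right after a departure would be bounded away from 0.\<close>

lemma stays_at_0:
  assumes "0 \<le> \<tau>" "\<tau> \<le> T" "q \<tau> = 0"
  shows "q T = 0"
proof -
  have "q T \<le> 0"
  proof (rule no_departure[OF assms(2), where f = q])
    fix s assume s: "\<tau> \<le> s" "s < T" "q s = 0"
    then have "0 \<le> s" using assms by simp
    show d0: "(q has_real_derivative 0) (at_right s)"
      using s(3) by (intro system_deriv_outside \<open>0 \<le> s\<close>) simp
    assume pos: "0 < q t" if "s < t" "t < T" for t
    have b: "F s \<le> F (q t + t)" if "s < t" for t
      using system_mono(2)[OF \<open>0 \<le> s\<close>, of t] that s(3) by (intro cdf_nondecreasing) simp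
    show "(\<forall>t\<in>{s<..<T}. \<exists>d\<le>0. (q has_real_derivative d) (at_right t)) \<or>
      (\<exists>c>0. eventually (\<lambda>t. \<exists>d\<ge>c. (q has_real_derivative d) (at_right t)) (at_right s))"
    proof (cases "2 * p \<le> F s")
      case True
      have "speed t \<le> 0" if "s < t" for t
        using True b[OF that] system_pos[of t] \<open>0 \<le> s\<close> that cdf_minus_bounds[of "q t - t"]
        by (auto simp: velocity_eq divide_nonpos_pos split: split_indicator)
      then show ?thesis
        using system_deriv \<open>0 \<le> s\<close> by (intro disjI1 ballI exI[of _ "speed _"]) auto
    next
      case False
      \<comment> \<open>Right continuity keeps \<open>2 * p - F (q t + t)\<close> above half of its
        value at \<open>s\<close>; as the denominator is at most 1, the same \<open>c\<close> bounds
        the velocity.\<close>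
      define c where "c = (2 * p - F s) / 2"
      have "0 < c" using False by (simp add: c_def)
      have "((\<lambda>t. q t + t) \<longlongrightarrow> s) (at_right s)"
        using tendsto_add[OF system_lim[OF \<open>0 \<le> s\<close>] tendsto_ident_at] s(3) by simp
      moreover have "eventually (\<lambda>t. s \<le> q t + t) (at_right s)"
        using system_mono(2)[OF \<open>0 \<le> s\<close>] s(3) by (fastforce simp: eventually_at_filter)
      ultimately have "((\<lambda>t. F (q t + t)) \<longlongrightarrow> F s) (at_right s)"
        by (rule tendsto_cdf_right)
      then have ev1: "eventually (\<lambda>t. F (q t + t) < 2 * p - c) (at_right s)"
        by (rule order_tendstoD) (use False in \<open>simp add: c_def field_simps\<close>)
      have ev2: "eventually (\<lambda>t. q t < 1) (at_right s)"
        using order_tendstoD(2)[OF system_lim[OF \<open>0 \<le> s\<close>], of 1] s(3) by simp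
      \<comment> \<open>The zero right derivative gives \<open>q t < t - s\<close>, which places the
        lower end \<open>q t - t\<close> below 0, where there is no mass.\<close>
      have ev3: "eventually (\<lambda>t. (q t - q s) / (t - s) < 1) (at_right s)"
        using d0 by (intro order_tendstoD(2)[of _ 0]) (simp_all add: has_field_derivative_iff)
      have ev4: "eventually (\<lambda>t. s < t \<and> t < T) (at_right s)"
        using s(2) by (auto simp: eventually_at_right_field)
      have "eventually (\<lambda>t. \<exists>d\<ge>c. (q has_real_derivative d) (at_right t)) (at_right s)"
        using ev1 ev2 ev3 ev4
      proof eventually_elim
        case (elim t)
        have "q t - t \<le> 0"
          using elim(3,4) s(3) \<open>0 \<le> s\<close> by (simp add: divide_less_eq)
        then have "F_minus (q t - t) = 0"
          by (rule cdf_minus_nonpos)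
        moreover have "0 < F (q t + t)" "F (q t + t) \<le> 1"
          using system_pos[of t] elim(4) \<open>0 \<le> s\<close> calculation cdf_bounded_prob by auto
        moreover have "c * F (q t + t) \<le> c * 1"
          using \<open>0 < c\<close> calculation by (intro mult_left_mono) auto
        ultimately have "c \<le> velocity M p q t"
          using elim(1) by (simp add: velocity_eq pos_le_divide_eq)
        then have "c \<le> speed t"
          using elim pos[of t] by simp
        then show ?case
          using system_deriv[of t] elim(4) \<open>0 \<le> s\<close> by auto
      qed
      then show ?thesis
        using \<open>0 < c\<close> by blast
    qed
  qed (use assms in \<open>auto intro!: system_cont\<close>)
  then show ?thesis
    using system_range[of T] assms by simp
qed

text \<open>The mirror image, applied to \<open>1 - q t\<close>: when the upper end is beyond 1, the
  velocity is \<open>(2 * p - 1 - F_minus (q t - t)) / (1 - F_minus (q t - t))\<close>, so the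
  threshold for \<open>F_minus (1 - s)\<close> is \<open>2 * p - 1\<close>.\<close>

lemma stays_at_1:
  assumes "0 \<le> \<tau>" "\<tau> \<le> T" "q \<tau> = 1"
  shows "q T = 1"
proof -
  have "1 - q T \<le> 0"
  proof (rule no_departure[OF assms(2), where f = "\<lambda>t. 1 - q t"])
    have deriv: "((\<lambda>t. 1 - q t) has_real_derivative - d) (at_right t)"
      if "(q has_real_derivative d) (at_right t)" for d t
      by (rule derivative_eq_intros that refl | simp)+
    fix s assume s: "\<tau> \<le> s" "s < T" "1 - q s = 0"
    then have "0 \<le> s" using assms by simp
    have d0: "(q has_real_derivative 0) (at_right s)"
      using s(3) by (intro system_deriv_outside \<open>0 \<le> s\<close>) simp
    then show "((\<lambda>t. 1 - q t) has_real_derivative 0) (at_right s)"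
      using deriv by fastforce
    assume pos: "0 < 1 - q t" if "s < t" "t < T" for t
    have a: "F_minus (q t - t) \<le> F_minus (1 - s)" if "s < t" for t
      using system_mono(1)[OF \<open>0 \<le> s\<close>, of t] that s(3) by (intro cdf_minus_mono) simp
    show "(\<forall>t\<in>{s<..<T}. \<exists>d\<le>0. ((\<lambda>t. 1 - q t) has_real_derivative d) (at_right t)) \<or>
      (\<exists>c>0. eventually (\<lambda>t. \<exists>d\<ge>c. ((\<lambda>t. 1 - q t) has_real_derivative d) (at_right t)) (at_right s))"
    proof (cases "F_minus (1 - s) \<le> 2 * p - 1")
      case True
      have "0 \<le> speed t" if "s < t" for t
        using True a[OF that] system_pos[of t] \<open>0 \<le> s\<close> that cdf_bounded_prob[of "q t + t"]
        by (auto simp: velocity_eq intro!: divide_nonneg_pos split: split_indicator)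
      then show ?thesis
        using deriv[OF system_deriv] \<open>0 \<le> s\<close> by (intro disjI1 ballI exI[of _ "- speed _"]) auto
    next
      case False
      define c where "c = (F_minus (1 - s) - (2 * p - 1)) / 2"
      have "0 < c" using False by (simp add: c_def)
      have "((\<lambda>t. q t - t) \<longlongrightarrow> 1 - s) (at_right s)"
        using tendsto_diff[OF system_lim[OF \<open>0 \<le> s\<close>] tendsto_ident_at] s(3) by simp
      moreover have "eventually (\<lambda>t. q t - t \<le> 1 - s) (at_right s)"
        using system_mono(1)[OF \<open>0 \<le> s\<close>] s(3) by (fastforce simp: eventually_at_filter)
      ultimately have "((\<lambda>t. F_minus (q t - t)) \<longlongrightarrow> F_minus (1 - s)) (at_right s)"
        by (rule tendsto_cdf_minus_left)
      then have ev1: "eventually (\<lambda>t. 2 * p - 1 + c < F_minus (q t - t)) (at_right s)"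
        by (rule order_tendstoD) (use False in \<open>simp add: c_def field_simps\<close>)
      have ev2: "eventually (\<lambda>t. 0 < q t) (at_right s)"
        using order_tendstoD(1)[OF system_lim[OF \<open>0 \<le> s\<close>], of 0] s(3) by simp
      \<comment> \<open>This gives \<open>q t + t > 1 + s\<close>, so \<open>F\<close> equals 1 at
        the upper end.\<close>
      have ev3: "eventually (\<lambda>t. - 1 < (q t - q s) / (t - s)) (at_right s)"
        using d0 by (intro order_tendstoD(1)[of _ 0]) (simp_all add: has_field_derivative_iff)
      have ev4: "eventually (\<lambda>t. s < t \<and> t < T) (at_right s)"
        using s(2) by (auto simp: eventually_at_right_field)
      have "eventually (\<lambda>t. \<exists>d\<ge>c. ((\<lambda>t. 1 - q t) has_real_derivative d) (at_right t)) (at_right s)"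
        using ev1 ev2 ev3 ev4
      proof eventually_elim
        case (elim t)
        have "1 \<le> q t + t"
          using elim(3,4) s(3) \<open>0 \<le> s\<close> by (simp add: less_divide_eq)
        then have F1: "F (q t + t) = 1"
          by (rule cdf_ge_1)
        have D: "0 < 1 - F_minus (q t - t)"
          using system_pos[of t] elim(4) \<open>0 \<le> s\<close> F1 by simp
        have "c * (1 - F_minus (q t - t)) \<le> c * 1"
          using \<open>0 < c\<close> cdf_minus_bounds[of "q t - t"] by (intro mult_left_mono) auto
        then have "velocity M p q t \<le> - c"
          using elim(1) D F1 by (simp add: velocity_eq pos_divide_le_eq)
        then have "c \<le> - speed t"
          using elim pos[of t] by simp
        then show ?case
          using deriv[OF system_deriv[of t]] elim(4) \<open>0 \<le> s\<close> by auto
      qed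
      then show ?thesis
        using \<open>0 < c\<close> by blast
    qed
  qed (use assms in \<open>auto intro!: system_cont continuous_intros\<close>)
  then show ?thesis
    using system_range[of T] assms by simp
qed

text \<open>Up to and including the first exit of \<open>q\<close>, both paths are balanced and
  hence equal, so they exit together; afterwards \<open>q\<close> stays at the boundary point at
  which \<open>r\<close> is stopped.\<close>

lemma system_unique:
  assumes eqn: "solves_equation M p r" and "0 \<le> t"
  shows "q t = stopped_at_exit r t"
proof -
  have eq: "q s = r s" if "0 \<le> s" "\<forall>u\<in>{0..<s}. q u \<in> {0<..<1}" for s
    using balanced_unique[OF system_balanced[OF that] equation_balanced[OF eqn that(1)]] .
  show ?thesis
    using system_cont[of "{0..}", simplified]
  proof (cases rule: first_exit[of q t])
    case 1
    then have "\<forall>s\<in>{0..t}. q s = r s"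
      by (auto intro!: eq)
    then show ?thesis
      using 1 \<open>0 \<le> t\<close> stopped_at_exit_inside[of t r] by simp
  next
    case (2 \<tau>)
    have "q s = r s" if "s \<in> {0..\<tau>}" for s
      using that 2(4) by (intro eq) auto
    then have "stopped_at_exit r t = q \<tau>"
      using stopped_at_exit_outside[of \<tau> r t] 2 by simp
    moreover have "q \<tau> = 0 \<or> q \<tau> = 1"
      using 2(3) system_range[OF 2(1)] by auto
    then have "q t = q \<tau>"
      using stays_at_0[OF 2(1,2)] stays_at_1[OF 2(1,2)] by auto
    ultimately show ?thesis by simp
  qed
qed

end

end

theorem proposition2p3:
  fixes M :: "real measure" and p :: real
  assumes "real_distribution M" and "measure M {0..1} = 1"
    and "0 < p" and "p < 1"
  shows
    "((\<forall>x > quantile M p. 0 < measure M {quantile M p..x}) \<longrightarrow> (\<exists>q. solves_equation M p q)) \<and>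
     (\<forall>q. solves_equation M p q \<longrightarrow>
        (\<forall>q'. solves_equation M p q' \<longrightarrow> (\<forall>t\<ge>0. q' t = q t)) \<and>
        solves_system M p (stopped_at_exit q) \<and>
        (\<forall>q'. solves_system M p q' \<longrightarrow> (\<forall>t\<ge>0. q' t = stopped_at_exit q t)))"
proof -
  interpret auction M p
    using assms by (simp add: auction_def auction_axioms_def)
  show ?thesis
    using equation_exists stopped_solves_system system_unique
      balanced_unique[OF equation_balanced equation_balanced]
    by blast
qed

end
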